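(* Let $W$ be any set (finite or infinite) with more than three elements. Then there is no RPM revision rule $f$ over $W$ that satisfies all three of the conditions (B9), (B10) and (R), where, writing $f(r,A)$ for $f(r,\langle A,\mathrm{bel}\rangle)$ and $\neg A$ for $W\setminus A$: (B9) for every RPM $r$ over $W$ and all nonempty $A,B\subseteq W$ with $B\subseteq A$, $\mathrm{Bel}(f(f(r,A),B))=\mathrm{Bel}(f(r,B))$; (B10) for every RPM $r$ over $W$ and all nonempty $A,B\subseteq W$ with $B\subseteq \neg A$, $\mathrm{Bel}(f(f(r,A),B))=\mathrm{Bel}(f(r,B))$; (R) for every RPM $r$ over $W$ and every admissible epistemic input $\langle A,\alpha\rangle$, there exists an epistemic attitude $\beta$ such that $\langle A,\beta\rangle$ is admissible and $f(f(r,\langle A,\alpha\rangle),\langle A,\beta\rangle)=r$. Equivalently, every RPM revision rule over $W$ that satisfies (B9) and (B10) fails to satisfy (R).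
   Context: Elements of $W$ are called worlds. A proposition is an arbitrary subset $A\subseteq W$; its negation is $\neg A=W\setminus A$; $A$ entails $B$ iff $A\subseteq B$. A ranked preferential model (RPM) over $W$ is a well-ordered partition of $W$: a finite or infinite sequence $r=\langle E_0,E_1,\ldots\rangle$ of pairwise disjoint nonempty subsets of $W$ whose union is $W$ (earlier elements contain the more believable worlds). Two RPMs are equal iff they are the same sequence of sets. The belief set of $r=\langle E_0,E_1,\ldots\rangle$ is $\mathrm{Bel}(r)=\{A\subseteq W: E_0\subseteq A\}$. For a nonempty proposition $A$, let $E_i$ be the first element of $r$ with $E_i\cap A\neq\emptyset$. The belief set that results from revising $r$ by belief in $A$ is $r^*_A=\{B\subseteq W: E_i\cap A\subseteq B\}$. The epistemic attitudes are the three symbols $\mathrm{bel}$ (belief), $\mathrm{dis}$ (disbelief) and $\mathrm{sus}$ (suspension of judgment). An epistemic input is a pair $\langle A,\alpha\rangle$ with $A\subseteq W$ and $\alpha$ an epistemic attitude. It is admissible if: $A\neq\emptyset$ when $\alpha=\mathrm{bel}$; $A\neq W$ when $\alpha=\mathrm{dis}$; $\emptyset\neq A\neq W$ when $\alpha=\mathrm{sus}$. An RPM revision rule over $W$ is a function $f$ that assigns to each RPM $r$ over $W$ and each admissible epistemic input $\langle A,\alpha\rangle$ an RPM $f(r,\langle A,\alpha\rangle)$ over $W$ (the new ranking of worlds), such that for every RPM $r$: (1) $\mathrm{Bel}(f(r,\langle A,\mathrm{bel}\rangle))=r^*_A$ for every nonempty $A$; (2) $f(r,\langle A,\mathrm{dis}\rangle)=f(r,\langle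 \neg A,\mathrm{bel}\rangle)$ for every $A\neq W$ (disbelieving $A$ is believing $\neg A$); (3) $\mathrm{Bel}(f(r,\langle A,\mathrm{sus}\rangle))=\mathrm{Bel}(f(r,\langle A,\mathrm{bel}\rangle))\cap \mathrm{Bel}(f(r,\langle A,\mathrm{dis}\rangle))$ for every $A$ with $\emptyset\neq A\neq W$. *)

theory Defs
  imports Main "HOL-Library.Disjoint_Sets"
begin

text \<open>
  A well-ordered sequence of distinct sets \<open>\<langle>E\<^sub>0, E\<^sub>1, \<dots>\<rangle>\<close> is encoded by the reflexive
  well-order on its terms: \<open>(E, F) \<in> r\<close> iff \<open>E = F\<close> or \<open>E\<close> comes before \<open>F\<close>. The set of terms
  is \<open>Field r\<close>, and two such sequences are the same iff the relations are equal, since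
  isomorphic well-orders have a unique isomorphism.
\<close>

type_synonym 'w ranking = "'w set rel"

definition RPMs :: "'w set \<Rightarrow> 'w ranking set" where
  "RPMs W = {r. Well_order r \<and> partition_on W (Field r)}"

text \<open>
  \<open>RPMs\<close> allows well-ordered partitions of any ordinal length. In \<open>seq_RPMs\<close> every term has
  only finitely many predecessors, so that the partition is a finite sequence or one indexed
  by the natural numbers.
\<close>

definition seq_RPMs :: "'w set \<Rightarrow> 'w ranking set" where
  "seq_RPMs W = {r \<in> RPMs W. \<forall>E\<in>Field r. finite (underS r E)}"

definition Bel :: "'w set \<Rightarrow> 'w ranking \<Rightarrow> 'w set set" where
  "Bel W r = {A. A \<subseteq> W \<and> wo_rel.minim r (Field r) \<subseteq> A}"

definition first_meeting :: "'w ranking \<Rightarrow> 'w set \<Rightarrow> 'w set" where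
  "first_meeting r A = wo_rel.minim r {E \<in> Field r. E \<inter> A \<noteq> {}}"

definition revised_Bel :: "'w set \<Rightarrow> 'w ranking \<Rightarrow> 'w set \<Rightarrow> 'w set set" where
  "revised_Bel W r A = {B. B \<subseteq> W \<and> first_meeting r A \<inter> A \<subseteq> B}"

datatype attitude = bel | dis | sus

type_synonym 'w input = "'w set \<times> attitude"

fun admissible :: "'w set \<Rightarrow> 'w input \<Rightarrow> bool" where
  "admissible W (A, bel) \<longleftrightarrow> A \<subseteq> W \<and> A \<noteq> {}"
| "admissible W (A, dis) \<longleftrightarrow> A \<subseteq> W \<and> A \<noteq> W"
| "admissible W (A, sus) \<longleftrightarrow> A \<subseteq> W \<and> A \<noteq> {} \<and> A \<noteq> W"

text \<open>
  Below, \<open>M\<close> is the set of RPMs over \<open>W\<close>, to be instantiated by \<open>RPMs W\<close> or \<open>seq_RPMs W\<close>.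
  Values of \<open>f\<close> outside \<open>M\<close> or on inadmissible inputs are irrelevant.
\<close>

definition revision_rule ::
  "'w set \<Rightarrow> 'w ranking set \<Rightarrow> ('w ranking \<Rightarrow> 'w input \<Rightarrow> 'w ranking) \<Rightarrow> bool" where
  "revision_rule W M f \<longleftrightarrow>
     (\<forall>r\<in>M. \<forall>i. admissible W i \<longrightarrow> f r i \<in> M) \<and>
     (\<forall>r\<in>M. \<forall>A. A \<subseteq> W \<and> A \<noteq> {} \<longrightarrow> Bel W (f r (A, bel)) = revised_Bel W r A) \<and>
     (\<forall>r\<in>M. \<forall>A. A \<subseteq> W \<and> A \<noteq> W \<longrightarrow> f r (A, dis) = f r (W - A, bel)) \<and>
     (\<forall>r\<in>M. \<forall>A. A \<subseteq> W \<and> A \<noteq> {} \<and> A \<noteq> W \<longrightarrow>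
        Bel W (f r (A, sus)) = Bel W (f r (A, bel)) \<inter> Bel W (f r (A, dis)))"

definition B9 ::
  "'w set \<Rightarrow> 'w ranking set \<Rightarrow> ('w ranking \<Rightarrow> 'w input \<Rightarrow> 'w ranking) \<Rightarrow> bool" where
  "B9 W M f \<longleftrightarrow>
     (\<forall>r\<in>M. \<forall>A B. A \<subseteq> W \<and> A \<noteq> {} \<and> B \<noteq> {} \<and> B \<subseteq> A \<longrightarrow>
        Bel W (f (f r (A, bel)) (B, bel)) = Bel W (f r (B, bel)))"

definition B10 ::
  "'w set \<Rightarrow> 'w ranking set \<Rightarrow> ('w ranking \<Rightarrow> 'w input \<Rightarrow> 'w ranking) \<Rightarrow> bool" where
  "B10 W M f \<longleftrightarrow>
     (\<forall>r\<in>M. \<forall>A B. A \<subseteq> W \<and> A \<noteq> {} \<and> B \<noteq> {} \<and> B \<subseteq> W - A \<longrightarrow>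
        Bel W (f (f r (A, bel)) (B, bel)) = Bel W (f r (B, bel)))"

definition reversible ::
  "'w set \<Rightarrow> 'w ranking set \<Rightarrow> ('w ranking \<Rightarrow> 'w input \<Rightarrow> 'w ranking) \<Rightarrow> bool" where
  "reversible W M f \<longleftrightarrow>
     (\<forall>r\<in>M. \<forall>A \<alpha>. admissible W (A, \<alpha>) \<longrightarrow>
        (\<exists>\<beta>. admissible W (A, \<beta>) \<and> f (f r (A, \<alpha>)) (A, \<beta>) = r))"

end

theory Submission
  imports Defs
begin

text \<open>
  Fix distinct worlds \<open>a\<close> and \<open>b\<close>, let \<open>C\<close> be the set of the remaining ones, and let
  \<open>r = \<langle>{b}, {a}, C\<rangle>\<close> and \<open>r' = \<langle>{b}, {a} \<union> C\<rangle>\<close>. Revision by belief in \<open>{a}\<close> puts \<open>{a}\<close> first,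
  and by (B10) it keeps the order of the other worlds, on which \<open>r\<close> and \<open>r'\<close> agree. So both
  are revised to the same \<open>q = \<langle>{a}, {b}, C\<rangle>\<close>. Since \<open>b\<close> alone is most believable in both \<open>r\<close>
  and \<open>r'\<close>, each of them can be recovered from \<open>q\<close> only by disbelief in \<open>{a}\<close>; hence
  \<open>r = r'\<close>, which is absurd.
\<close>

section \<open>The preorder of worlds induced by a ranking, and belief sets as its minima\<close>

definition world_le :: "'w ranking \<Rightarrow> 'w \<Rightarrow> 'w \<Rightarrow> bool" where
  "world_le r x y \<longleftrightarrow> (\<exists>E F. (E, F) \<in> r \<and> x \<in> E \<and> y \<in> F)"

context
  fixes W :: "'w set" and r :: "'w ranking"
  assumes r: "r \<in> RPMs W"
begin

lemma RPMs_wo_rel: "wo_rel r"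
  using r by (simp add: RPMs_def wo_rel_def)

lemma RPMs_partition: "partition_on W (Field r)"
  using r by (simp add: RPMs_def)

lemma RPMs_cell_unique:
  assumes "E \<in> Field r" "F \<in> Field r" "x \<in> E" "x \<in> F"
  shows "E = F"
  using partition_onD2[OF RPMs_partition] assms by (auto dest: disjointD)

lemma RPMs_cell_subset: "E \<in> Field r \<Longrightarrow> E \<subseteq> W"
  using partition_onD1[OF RPMs_partition] by auto

lemma RPMs_cell_nonempty: "E \<in> Field r \<Longrightarrow> E \<noteq> {}"
  using partition_onD3[OF RPMs_partition] by auto

lemma RPMs_cell_exists: "x \<in> W \<Longrightarrow> \<exists>E\<in>Field r. x \<in> E"
  using partition_onD1[OF RPMs_partition] by auto

lemma world_le_cells:
  assumes "E \<in> Field r" "F \<in> Field r" "x \<in> E" "y \<in> F"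
  shows "world_le r x y \<longleftrightarrow> (E, F) \<in> r"
proof
  assume "world_le r x y"
  then obtain E' F' where *: "(E', F') \<in> r" "x \<in> E'" "y \<in> F'"
    by (auto simp: world_le_def)
  then have "E' = E" "F' = F"
    using RPMs_cell_unique assms by (meson FieldI1 FieldI2)+
  with * show "(E, F) \<in> r" by simp
qed (use assms in \<open>auto simp: world_le_def\<close>)

text \<open>Mutual comparability of worlds means mutual comparability of their cells, which
  antisymmetry of \<open>r\<close> turns into equality. The cells are thus the equivalence classes
  of the preorder.\<close>

lemma world_le_cell_eq:
  assumes "E \<in> Field r" "x \<in> E"
  shows "E = {y \<in> W. world_le r x y \<and> world_le r y x}"
proof -
  have "y \<in> E \<longleftrightarrow> world_le r x y \<and> world_le r y x" if y: "y \<in> W" for y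
  proof -
    obtain F where F: "F \<in> Field r" "y \<in> F"
      using RPMs_cell_exists y by blast
    have "y \<in> E \<longleftrightarrow> E = F"
      using RPMs_cell_unique assms F by blast
    also have "\<dots> \<longleftrightarrow> (E, F) \<in> r \<and> (F, E) \<in> r"
      using wo_rel.ANTISYM[OF RPMs_wo_rel] wo_rel.REFL[OF RPMs_wo_rel] assms(1)
      by (auto dest: antisymD refl_onD)
    finally show ?thesis
      using world_le_cells assms F by simp
  qed
  then show ?thesis
    using RPMs_cell_subset[OF assms(1)] by blast
qed

text \<open>Rebuilds \<open>r\<close> from \<open>world_le r\<close> alone, with each cell written
  as an equivalence class; hence the preorder determines the ranking.\<close>

lemma ranking_eq_world_le:
  "r = (\<lambda>(x, y). ({z \<in> W. world_le r x z \<and> world_le r z x},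
                     {z \<in> W. world_le r y z \<and> world_le r z y}))
         ` {(x, y). x \<in> W \<and> y \<in> W \<and> world_le r x y}" (is "r = ?c ` ?P")
proof (intro set_eqI iffI; clarify)
  fix E F assume EF: "(E, F) \<in> r"
  then have f: "E \<in> Field r" "F \<in> Field r"
    by (auto simp: Field_def)
  then obtain x y where "x \<in> E" "y \<in> F"
    using RPMs_cell_nonempty by blast
  then have "(E, F) = ?c (x, y)" "(x, y) \<in> ?P"
    using world_le_cell_eq[OF f(1)] world_le_cell_eq[OF f(2)] world_le_cells[OF f] EF
      RPMs_cell_subset f by auto
  then show "(E, F) \<in> ?c ` ?P"
    by (rule image_eqI)
next
  fix x y assume *: "x \<in> W" "y \<in> W" "world_le r x y"
  then obtain E F where E: "E \<in> Field r" "x \<in> E" and F: "F \<in> Field r" "y \<in> F"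
    using RPMs_cell_exists by meson
  then show "({z \<in> W. world_le r x z \<and> world_le r z x},
      {z \<in> W. world_le r y z \<and> world_le r z y}) \<in> r"
    using world_le_cells[OF E(1) F(1) E(2) F(2)] *(3)
    unfolding world_le_cell_eq[OF E, symmetric] world_le_cell_eq[OF F, symmetric] by simp
qed

text \<open>Trades the well-order minimum for a condition on worlds. The first cell meeting
  \<open>A\<close> lies below every cell meeting \<open>A\<close>, and by antisymmetry it is the
  only such cell with this property.\<close>

lemma mem_first_meeting_iff:
  assumes "A \<subseteq> W" "A \<noteq> {}"
  shows "x \<in> first_meeting r A \<inter> A \<longleftrightarrow> x \<in> A \<and> (\<forall>y\<in>A. world_le r x y)"
proof -
  define S where "S = {E \<in> Field r. E \<inter> A \<noteq> {}}"
  have sub: "S \<subseteq> Field r"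
    by (auto simp: S_def)
  have ne: "S \<noteq> {}"
    using assms RPMs_cell_exists by (fastforce simp: S_def)
  have fm: "first_meeting r A = wo_rel.minim r S"
    by (simp add: first_meeting_def S_def)
  have m: "first_meeting r A \<in> S"
    using wo_rel.minim_in[OF RPMs_wo_rel sub ne] fm by simp
  have least: "(first_meeting r A, E) \<in> r" if "E \<in> S" for E
    using wo_rel.minim_least[OF RPMs_wo_rel sub that] fm by simp
  show ?thesis
  proof (safe)
    fix y assume "x \<in> first_meeting r A" "x \<in> A" "y \<in> A"
    moreover obtain F where "F \<in> Field r" "y \<in> F"
      using RPMs_cell_exists assms \<open>y \<in> A\<close> by blast
    ultimately show "world_le r x y"
      using least[of F] by (auto simp: world_le_def S_def)
  next
    assume x: "x \<in> A" "\<forall>y\<in>A. world_le r x y"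
    obtain E where E: "E \<in> Field r" "x \<in> E"
      using RPMs_cell_exists assms x by blast
    obtain y where y: "y \<in> first_meeting r A" "y \<in> A"
      using m by (auto simp: S_def)
    have "(E, first_meeting r A) \<in> r"
      using world_le_cells[OF E(1) _ E(2) y(1)] x y m by (auto simp: S_def)
    moreover have "(first_meeting r A, E) \<in> r"
      using least E x by (auto simp: S_def)
    ultimately show "x \<in> first_meeting r A"
      using wo_rel.ANTISYM[OF RPMs_wo_rel] E by (auto dest: antisymD)
  qed
qed

lemma revised_Bel_eq:
  assumes "A \<subseteq> W" "A \<noteq> {}"
  shows "revised_Bel W r A = {B. B \<subseteq> W \<and> {x \<in> A. \<forall>y\<in>A. world_le r x y} \<subseteq> B}"
proof -
  have "first_meeting r A \<inter> A = {x \<in> A. \<forall>y\<in>A. world_le r x y}"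
    using mem_first_meeting_iff[OF assms] by auto
  then show ?thesis
    by (simp add: revised_Bel_def)
qed

text \<open>Every cell is nonempty and lies inside \<open>W\<close>, so the first cell meeting
  \<open>W\<close> is simply the first cell. Belief sets thereby fall under the description of
  revised belief sets.\<close>

lemma Bel_eq_revised_Bel:
  assumes "W \<noteq> {}"
  shows "Bel W r = revised_Bel W r W"
proof -
  have S: "{E \<in> Field r. E \<inter> W \<noteq> {}} = Field r"
    using RPMs_cell_nonempty RPMs_cell_subset by blast
  have "Field r \<noteq> {}"
    using RPMs_cell_exists assms by blast
  then have "wo_rel.minim r (Field r) \<in> Field r"
    using wo_rel.minim_in[OF RPMs_wo_rel] by blast
  then have "wo_rel.minim r (Field r) \<inter> W = wo_rel.minim r (Field r)"
    using RPMs_cell_subset by blast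
  then show ?thesis
    by (simp add: Bel_def revised_Bel_def first_meeting_def S)
qed

lemma Bel_eq:
  assumes "W \<noteq> {}"
  shows "Bel W r = {B. B \<subseteq> W \<and> {x \<in> W. \<forall>y\<in>W. world_le r x y} \<subseteq> B}"
  unfolding Bel_eq_revised_Bel[OF assms] by (rule revised_Bel_eq[OF subset_refl assms])

end

text \<open>A principal filter determines its generator: \<open>X\<close> and \<open>Y\<close> each
  belong to their own filter, hence to the other's.\<close>

lemma upper_sets_eqD:
  assumes "{B. B \<subseteq> W \<and> X \<subseteq> B} = {B. B \<subseteq> W \<and> Y \<subseteq> B}" "X \<subseteq> W" "Y \<subseteq> W"
  shows "X = Y"
proof
  show "X \<subseteq> Y"
    using assms(1,3) by (auto dest: equalityD2[THEN subsetD, of _ _ Y])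
  show "Y \<subseteq> X"
    using assms(1,2) by (auto dest: equalityD1[THEN subsetD, of _ _ X])
qed

lemma RPMs_eqI:
  assumes r: "r \<in> RPMs W" and s: "s \<in> RPMs W"
    and le: "\<And>x y. x \<in> W \<Longrightarrow> y \<in> W \<Longrightarrow> world_le r x y \<longleftrightarrow> world_le s x y"
  shows "r = s"
proof -
  have cell: "{z \<in> W. world_le r x z \<and> world_le r z x} = {z \<in> W. world_le s x z \<and> world_le s z x}"
    if "x \<in> W" for x
    using le that by blast
  show ?thesis
    by (subst ranking_eq_world_le[OF r], subst ranking_eq_world_le[OF s])
      (rule image_cong; use le cell in auto)
qed

lemma world_le_refl:
  assumes "r \<in> RPMs W" "x \<in> W"
  shows "world_le r x x"
proof -
  obtain E where "E \<in> Field r" "x \<in> E"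
    using RPMs_cell_exists assms by metis
  then show ?thesis
    using wo_rel.REFL[OF RPMs_wo_rel[OF assms(1)]] by (auto simp: world_le_def dest: refl_onD)
qed

text \<open>A pair serves as a probe: \<open>x\<close> is among the minimal worlds of
  \<open>{x, y}\<close> exactly when it is at least as believable as \<open>y\<close>.\<close>

lemma world_le_iff_of_revised_Bel_eq:
  assumes r: "r \<in> RPMs W" and s: "s \<in> RPMs W" and xy: "x \<in> W" "y \<in> W"
    and eq: "revised_Bel W r {x, y} = revised_Bel W s {x, y}"
  shows "world_le r x y \<longleftrightarrow> world_le s x y"
proof -
  have "{u \<in> {x, y}. \<forall>v\<in>{x, y}. world_le r u v} = {u \<in> {x, y}. \<forall>v\<in>{x, y}. world_le s u v}"
    by (rule upper_sets_eqD[of W]) (use eq revised_Bel_eq[OF r] revised_Bel_eq[OF s] xy in auto)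
  then show ?thesis
    using world_le_refl[OF r xy(1)] world_le_refl[OF s xy(1)] by auto
qed

lemma world_le_trans:
  assumes r: "r \<in> RPMs W" and le: "world_le r x y" "world_le r y z"
  shows "world_le r x z"
proof -
  obtain E F F' G where EF: "(E, F) \<in> r" "x \<in> E" "y \<in> F" and FG: "(F', G) \<in> r" "y \<in> F'" "z \<in> G"
    using le by (auto simp: world_le_def)
  then have "F = F'"
    using RPMs_cell_unique[OF r] by (meson FieldI1 FieldI2)
  then have "(E, G) \<in> r"
    using EF FG wo_rel.TRANS[OF RPMs_wo_rel[OF r]] by (auto dest: transD)
  then show ?thesis
    using EF FG by (auto simp: world_le_def)
qed

section \<open>Rankings given by a rank function into the naturals\<close>

definition ranking_by :: "'w set \<Rightarrow> ('w \<Rightarrow> nat) \<Rightarrow> 'w ranking" where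
  "ranking_by W k = dir_image (Restr natLeq (k ` W)) (\<lambda>n. {x \<in> W. k x = n})"

lemma Field_Restr_natLeq: "Field (Restr natLeq K) = K"
  by (subst Refl_Field_Restr[OF natLeq_Refl]) (simp add: Field_natLeq)

lemma Field_ranking_by: "Field (ranking_by W k) = (\<lambda>n. {x \<in> W. k x = n}) ` k ` W"
  by (simp add: ranking_by_def dir_image_Field Field_Restr_natLeq)

lemma mem_ranking_by:
  "(E, F) \<in> ranking_by W k \<longleftrightarrow>
    (\<exists>x\<in>W. \<exists>y\<in>W. k x \<le> k y \<and> E = {z \<in> W. k z = k x} \<and> F = {z \<in> W. k z = k y})"
  by (auto simp: ranking_by_def dir_image_def natLeq_def)

text \<open>The well-order is transported from the naturals along the fibre map, which is injective
  on the ranks attained. Membership in the smaller class makes these rankings available for both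
  choices of \<open>M\<close>.\<close>

lemma ranking_by_seq_RPMs: "ranking_by W k \<in> seq_RPMs W"
proof -
  have "inj_on (\<lambda>n. {x \<in> W. k x = n}) (k ` W)"
    by (rule inj_onI) blast
  then have "Well_order (ranking_by W k)"
    unfolding ranking_by_def using Well_order_Restr[OF natLeq_Well_order]
    by (intro Well_order_dir_image) (simp_all add: Field_Restr_natLeq)
  moreover have "partition_on W (Field (ranking_by W k))"
    unfolding Field_ranking_by by (rule partition_onI) (auto simp: disjnt_def)
  moreover have "finite (underS (ranking_by W k) E)" if E: "E \<in> Field (ranking_by W k)" for E
  proof -
    obtain x where x: "x \<in> W" "E = {z \<in> W. k z = k x}"
      using E unfolding Field_ranking_by by blast
    \<comment> \<open>Predecessors of \<open>E\<close> are fibres over ranks at most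
      \<open>k x\<close>; ranks that are not attained contribute only the empty set to the finite
      bound.\<close>
    have "underS (ranking_by W k) E \<subseteq> (\<lambda>n. {z \<in> W. k z = n}) ` {..k x}"
      using x by (fastforce simp: underS_def mem_ranking_by)
    then show ?thesis
      using finite_surj by blast
  qed
  ultimately show ?thesis
    by (simp add: seq_RPMs_def RPMs_def)
qed

lemma world_le_ranking_by:
  "x \<in> W \<Longrightarrow> y \<in> W \<Longrightarrow> world_le (ranking_by W k) x y \<longleftrightarrow> k x \<le> k y"
  by (auto simp: world_le_def mem_ranking_by)

section \<open>Consequences of the revision postulates, (B10) and reversibility\<close>

context
  fixes W :: "'w set" and M :: "'w ranking set" and f :: "'w ranking \<Rightarrow> 'w input \<Rightarrow> 'w ranking"
  assumes M: "M \<subseteq> RPMs W" and f: "revision_rule W M f"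
begin

lemma revision_closed: "r \<in> M \<Longrightarrow> admissible W i \<Longrightarrow> f r i \<in> M"
  by (rule f[unfolded revision_rule_def, THEN conjunct1, rule_format])

lemma revision_Bel:
  "r \<in> M \<Longrightarrow> A \<subseteq> W \<Longrightarrow> A \<noteq> {} \<Longrightarrow> Bel W (f r (A, bel)) = revised_Bel W r A"
  using f by (simp add: revision_rule_def)

text \<open>The new belief set is the filter generated by \<open>{x}\<close>, so \<open>x\<close> is
  the only minimal world. Anything below \<open>x\<close> would be minimal too by transitivity,
  which makes \<open>x\<close> strictly first.\<close>

lemma revision_by_singleton:
  assumes r: "r \<in> M" and x: "x \<in> W" and y: "y \<in> W"
  shows "world_le (f r ({x}, bel)) x y" "world_le (f r ({x}, bel)) y x \<longleftrightarrow> y = x"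
proof -
  define q where "q = f r ({x}, bel)"
  have q: "q \<in> RPMs W"
    using revision_closed[OF r] x M by (auto simp: q_def)
  have rR: "r \<in> RPMs W"
    using r M by auto
  have ne: "W \<noteq> {}"
    using x by blast
  have "Bel W q = revised_Bel W r {x}"
    using revision_Bel[OF r] x by (simp add: q_def)
  also have "\<dots> = {B. B \<subseteq> W \<and> {x} \<subseteq> B}"
    using revised_Bel_eq[OF rR, of "{x}"] world_le_refl[OF rR x] x by auto
  finally have "{B. B \<subseteq> W \<and> {z \<in> W. \<forall>y\<in>W. world_le q z y} \<subseteq> B} = {B. B \<subseteq> W \<and> {x} \<subseteq> B}"
    unfolding Bel_eq[OF q ne] .
  then have least: "{z \<in> W. \<forall>y\<in>W. world_le q z y} = {x}"
    by (rule upper_sets_eqD) (use x in auto)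
  then show "world_le (f r ({x}, bel)) x y"
    using y unfolding q_def by blast
  have "y = x" if "world_le q y x"
  proof -
    have "world_le q y z" if "z \<in> W" for z
      using world_le_trans[OF q \<open>world_le q y x\<close>] least that by blast
    then show ?thesis
      using least y by blast
  qed
  then show "world_le (f r ({x}, bel)) y x \<longleftrightarrow> y = x"
    using world_le_refl[OF q x] unfolding q_def by blast
qed

text \<open>(B10) is applied to the pair \<open>{x, y}\<close>, which is disjoint from
  \<open>A\<close>; equal belief sets after this probe mean equal order of \<open>x\<close> and
  \<open>y\<close>.\<close>

lemma B10_world_le:
  assumes B10: "B10 W M f" and r: "r \<in> M" and A: "A \<subseteq> W" "A \<noteq> {}"
    and xy: "x \<in> W - A" "y \<in> W - A"
  shows "world_le (f r (A, bel)) x y \<longleftrightarrow> world_le r x y"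
proof -
  define q where "q = f r (A, bel)"
  have q: "q \<in> M"
    unfolding q_def by (rule revision_closed[OF r]) (simp add: A)
  have R: "q \<in> RPMs W" "r \<in> RPMs W"
    using M q r by (simp_all add: subsetD)
  have W: "x \<in> W" "y \<in> W" and B: "{x, y} \<subseteq> W" "{x, y} \<noteq> {}" "{x, y} \<subseteq> W - A"
    using xy by simp_all
  have "Bel W (f q ({x, y}, bel)) = Bel W (f r ({x, y}, bel))"
    unfolding q_def using B10[unfolded B10_def, rule_format, OF r] A B by simp
  then have "revised_Bel W q {x, y} = revised_Bel W r {x, y}"
    unfolding revision_Bel[OF q B(1,2)] revision_Bel[OF r B(1,2)] .
  then show ?thesis
    unfolding q_def[symmetric] by (rule world_le_iff_of_revised_Bel_eq[OF R W])
qed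

text \<open>Belief in \<open>A\<close> cannot restore \<open>r\<close>: some worlds of
  \<open>A\<close> would be most believable, whereas \<open>r\<close> believes the negation of
  \<open>A\<close>. Suspension cannot either, since its belief set is contained in the one for
  belief.\<close>

lemma reversal_is_disbelief:
  assumes rev: "reversible W M f" and r: "r \<in> M" and A: "A \<subseteq> W" "A \<noteq> {}" "A \<noteq> W"
    and B: "W - A \<in> Bel W r"
  shows "f (f r (A, bel)) (A, dis) = r"
proof -
  define q where "q = f r (A, bel)"
  have q: "q \<in> M"
    unfolding q_def by (rule revision_closed[OF r]) (simp add: A)
  have qR: "q \<in> RPMs W"
    using M q by (simp add: subsetD)
  have adm: "admissible W (A, bel)"
    using A by simp
  obtain \<beta> where \<beta>: "f q (A, \<beta>) = r"
    using rev[unfolded reversible_def, rule_format, OF r adm] unfolding q_def by blast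
  have "W - A \<notin> Bel W (f q (A, bel))"
  proof
    assume "W - A \<in> Bel W (f q (A, bel))"
    then have "first_meeting q A \<inter> A = {}"
      using revision_Bel[OF q A(1,2)] by (auto simp: revised_Bel_def)
    moreover have "first_meeting q A \<inter> A \<noteq> {}"
    proof -
      let ?S = "{E \<in> Field q. E \<inter> A \<noteq> {}}"
      have "?S \<noteq> {}"
        using RPMs_cell_exists[OF qR] A by fastforce
      then have "first_meeting q A \<in> ?S"
        unfolding first_meeting_def by (intro wo_rel.minim_in[OF RPMs_wo_rel[OF qR]]) auto
      then show ?thesis by simp
    qed
    ultimately show False by simp
  qed
  moreover have "Bel W (f q (A, sus)) \<subseteq> Bel W (f q (A, bel))"
    using f q A unfolding revision_rule_def by simp
  ultimately have "\<beta> = dis"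
    using \<beta> B by (cases \<beta>) auto
  with \<beta> show ?thesis
    by (simp add: q_def)
qed

end

section \<open>Two distinct rankings with a common revision\<close>

theorem mainTheorem1:
  fixes W :: "'w set" and M :: "'w ranking set"
  assumes "infinite W \<or> card W > 3"
    and "M = RPMs W \<or> M = seq_RPMs W"
  shows "\<not> (\<exists>f. revision_rule W M f \<and> B9 W M f \<and> B10 W M f \<and> reversible W M f)"
proof
  assume "\<exists>f. revision_rule W M f \<and> B9 W M f \<and> B10 W M f \<and> reversible W M f"
  then obtain f where f: "revision_rule W M f" and B10: "B10 W M f" and rev: "reversible W M f"
    by (elim exE conjE)
  have M: "M \<subseteq> RPMs W"
    using assms(2) by (auto simp: seq_RPMs_def)
  have sM: "seq_RPMs W \<subseteq> M"
    using assms(2) by (auto simp: seq_RPMs_def)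
  obtain T where T: "T \<subseteq> W" "card T = 3"
  proof (cases "finite W")
    case True
    then show ?thesis
      using assms(1) obtain_subset_with_card_n[of 3 W] that by auto
  next
    case False
    then show ?thesis
      using infinite_arbitrarily_large[of W 3] that by blast
  qed
  \<comment> \<open>The world \<open>c\<close> is a member of the third cell of \<open>r\<close>; it
    is what will tell \<open>r\<close> and \<open>r'\<close> apart.\<close>
  then obtain a b c where abc: "a \<in> W" "b \<in> W" "c \<in> W" "a \<noteq> b" "a \<noteq> c" "b \<noteq> c"
    by (auto simp: card_3_iff)
  define r r' where "r = ranking_by W (\<lambda>x. if x = b then 0 else if x = a then 1 else 2)"
    and "r' = ranking_by W (\<lambda>x. if x = b then 0 else 1)"
  have rM: "r \<in> M" "r' \<in> M"
    using ranking_by_seq_RPMs sM by (auto simp: r_def r'_def)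
  have le_r: "world_le r x y \<longleftrightarrow> x = b \<or> y \<noteq> b \<and> (x = a \<or> y \<noteq> a)" if "x \<in> W" "y \<in> W" for x y
    using that abc by (simp add: r_def world_le_ranking_by)
  have le_r': "world_le r' x y \<longleftrightarrow> x = b \<or> y \<noteq> b" if "x \<in> W" "y \<in> W" for x y
    using that by (simp add: r'_def world_le_ranking_by)
  have A: "{a} \<subseteq> W" "{a} \<noteq> {}" "{a} \<noteq> W"
    using abc by auto
  then have adm: "admissible W ({a}, bel)"
    by simp
  have q: "f r ({a}, bel) \<in> RPMs W" "f r' ({a}, bel) \<in> RPMs W"
    using revision_closed[OF M f rM(1) adm] revision_closed[OF M f rM(2) adm] M by (simp_all add: subsetD)
  have "f r ({a}, bel) = f r' ({a}, bel)"
  proof (rule RPMs_eqI[OF q])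
    fix x y assume xy: "x \<in> W" "y \<in> W"
    have first: "world_le (f s ({a}, bel)) a y" "world_le (f s ({a}, bel)) x a \<longleftrightarrow> x = a"
      if "s \<in> M" for s
      using revision_by_singleton[OF M f that abc(1)] xy by blast+
    show "world_le (f r ({a}, bel)) x y \<longleftrightarrow> world_le (f r' ({a}, bel)) x y"
    \<comment> \<open>Comparisons involving \<open>a\<close> are settled by \<open>a\<close> being
      strictly first after revision; all others are inherited through (B10) from \<open>r\<close>
      and \<open>r'\<close>, which agree away from \<open>a\<close>.\<close>
    proof (cases "x = a \<or> y = a")
      case True
      then show ?thesis using first rM by blast
    next
      case False
      then have xy': "x \<in> W - {a}" "y \<in> W - {a}"
        using xy by simp_all
      then have "world_le r x y \<longleftrightarrow> world_le r' x y"
        using le_r le_r' by simp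
      then show ?thesis
        using B10_world_le[OF M f B10 rM(1) A(1,2) xy'] B10_world_le[OF M f B10 rM(2) A(1,2) xy']
        by simp
    qed
  qed
  moreover have "W - {a} \<in> Bel W s" if s: "s \<in> {r, r'}" for s
  proof -
    have "s \<in> RPMs W" using s rM M by auto
    \<comment> \<open>In both rankings \<open>b\<close> is the only minimal world, and it differs
      from \<open>a\<close>.\<close>
    moreover have "{x \<in> W. \<forall>y\<in>W. world_le s x y} \<subseteq> W - {a}"
      using s le_r le_r' abc by blast
    ultimately show ?thesis
      using Bel_eq[of s W] A by auto
  qed
  ultimately have "r = r'"
    using reversal_is_disbelief[OF M f rev rM(1) A] reversal_is_disbelief[OF M f rev rM(2) A]
    by (metis insert_iff)
  \<comment> \<open>\<open>r\<close> puts \<open>a\<close> strictly before \<open>c\<close>, while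
    \<open>r'\<close> ties them.\<close>
  then show False
    using le_r[of c a] le_r'[of c a] abc by auto
qed

end
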